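(* Let $1<\alpha\le 2$, $1<\gamma\le 2$, $\lambda\ge 0$, $\beta=\gamma-1$. Then the difference scheme $$u_i^{n+1}-u_i^n=\frac{\tau^{\gamma}}{2}\sum_{k=0}^{n}l_k^{\beta}\,\nabla_h^{\alpha}\left(u_i^{n+1-k}+u_i^{n-k}\right)+\tau f_i^{n+\frac12},\qquad 1\le i\le M-1,\ 0\le n\le N-1,$$ with $u_0^n=u_M^n=0$ for all $n$, is unconditionally stable (in the discrete $L^2$ norm): for all step sizes $h=b/M$ and $\tau=T/N$, with no restriction relating $\tau$ and $h$, if $(u_i^n)$ and $(\widetilde u_i^n)$ are any two solutions of the scheme with the same source values $f_i^{n+\frac12}$ and the same homogeneous boundary values but possibly different initial values, then $\epsilon_i^n=\widetilde u_i^n-u_i^n$ satisfies $\|\epsilon^n\|\le\|\epsilon^0\|$ for all $0\le n\le N$.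
   Context: Grid: $b,T>0$, integers $M\ge 2$, $N\ge 1$, $h=b/M$, $\tau=T/N$, $x_i=ih$ ($0\le i\le M$), $t_n=n\tau$ ($0\le n\le N$), $t_{n+\frac12}=(n+\frac12)\tau$, $f_i^{n+\frac12}=f(x_i,t_{n+\frac12})$ for a given real function $f$. Discrete inner product and norm for grid functions: $(u^n,v^n)=h\sum_{i=1}^{M-1}u_i^nv_i^n$, $\|u^n\|=(u^n,u^n)^{1/2}$. Discrete Riesz derivative: for $1\le i\le M-1$, $$\nabla_h^{\alpha}u_i^n=-\frac{\kappa_\alpha}{\Gamma(4-\alpha)h^\alpha}\sum_{j=1}^{M-1}w_{i,j}^{\alpha}u_j^n,\qquad \kappa_\alpha=\frac{1}{2\cos(\alpha\pi/2)},$$ where $w_{i,j}^\alpha=w_{|i-j|+1}^\alpha$ if $|i-j|\ge 2$, $w_{i,j}^\alpha=w_0^\alpha+w_2^\alpha$ if $|i-j|=1$, $w_{i,i}^\alpha=2w_1^\alpha$, and $w_0^\alpha=1$, $w_1^\alpha=-4+2^{3-\alpha}$, $w_2^\alpha=6-2^{5-\alpha}+3^{3-\alpha}$, and for $m\ge 3$ $$w_m^\alpha=(m+1)^{3-\alpha}-4m^{3-\alpha}+6(m-1)^{3-\alpha}-4(m-2)^{3-\alpha}+(m-3)^{3-\alpha}.$$ Coefficients $l_k^\beta$ ($k\ge 0$): the Taylor coefficients at $z=0$ in $$\left(1-\frac{z}{e^{\lambda\tau}}\right)^{-\beta}\left(1+\frac12\left(1-\frac{z}{e^{\lambda\tau}}\right)\right)^{-\beta}=\sum_{k=0}^\infty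 l_k^\beta z^k.$$ Equivalently $l_k^{\beta}=e^{-\lambda k\tau}\left(\frac32\right)^{-\beta}\sum_{m=0}^k3^{-m}g_m^{-\beta}g_{k-m}^{-\beta}$, where $(1-z)^{-\beta}=\sum_{m\ge0}g_m^{-\beta}z^m$. *)

theory Defs
  imports "HOL-Analysis.Analysis"
begin

text \<open>
  A grid function is a function \<open>u :: nat \<Rightarrow> real\<close> of the space index, of which only the values at
  \<open>0, \<dots>, M\<close> matter; a time-dependent one is \<open>u :: nat \<Rightarrow> nat \<Rightarrow> real\<close>, with \<open>u n i\<close> the value
  at time level \<open>n\<close> and space index \<open>i\<close>.  The inner product and norm only see interior points.
\<close>

definition grid_inner :: "real \<Rightarrow> nat \<Rightarrow> (nat \<Rightarrow> real) \<Rightarrow> (nat \<Rightarrow> real) \<Rightarrow> real" where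
  "grid_inner h M u v = h * (\<Sum>i = 1..M - 1. u i * v i)"

definition grid_norm :: "real \<Rightarrow> nat \<Rightarrow> (nat \<Rightarrow> real) \<Rightarrow> real" where
  "grid_norm h M u = sqrt (grid_inner h M u u)"

text \<open>
  For \<open>m = 3\<close> the last summand is \<open>0 powr (3 - \<alpha>) = 0\<close>, as intended for \<open>\<alpha> < 3\<close>.
\<close>

definition riesz_w :: "real \<Rightarrow> nat \<Rightarrow> real" where
  "riesz_w \<alpha> m =
     (if m = 0 then 1
      else if m = 1 then - 4 + 2 powr (3 - \<alpha>)
      else if m = 2 then 6 - 2 powr (5 - \<alpha>) + 3 powr (3 - \<alpha>)
      else (real m + 1) powr (3 - \<alpha>) - 4 * real m powr (3 - \<alpha>)
           + 6 * (real m - 1) powr (3 - \<alpha>) - 4 * (real m - 2) powr (3 - \<alpha>)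
           + (real m - 3) powr (3 - \<alpha>))"

definition riesz_weight :: "real \<Rightarrow> nat \<Rightarrow> nat \<Rightarrow> real" where
  "riesz_weight \<alpha> i j =
     (let d = nat \<bar>int i - int j\<bar> in
      if d = 0 then 2 * riesz_w \<alpha> 1
      else if d = 1 then riesz_w \<alpha> 0 + riesz_w \<alpha> 2
      else riesz_w \<alpha> (d + 1))"

definition riesz_kappa :: "real \<Rightarrow> real" where
  "riesz_kappa \<alpha> = 1 / (2 * cos (\<alpha> * pi / 2))"

definition riesz_deriv :: "real \<Rightarrow> real \<Rightarrow> nat \<Rightarrow> (nat \<Rightarrow> real) \<Rightarrow> nat \<Rightarrow> real" where
  "riesz_deriv \<alpha> h M u i =
     - (riesz_kappa \<alpha> / (Gamma (4 - \<alpha>) * h powr \<alpha>)) * (\<Sum>j = 1..M - 1. riesz_weight \<alpha> i j * u j)"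

definition taylor_coeff :: "(real \<Rightarrow> real) \<Rightarrow> nat \<Rightarrow> real" where
  "taylor_coeff F k = (deriv ^^ k) F 0 / fact k"

text \<open>
  Both bases of the generating function are positive for \<open>z\<close> near \<open>0\<close>, so the real powers
  are the principal ones there.
\<close>

definition l_coeff :: "real \<Rightarrow> real \<Rightarrow> real \<Rightarrow> nat \<Rightarrow> real" where
  "l_coeff \<beta> lam \<tau> =
     taylor_coeff (\<lambda>z. (1 - z / exp (lam * \<tau>)) powr (- \<beta>)
                       * (1 + 1/2 * (1 - z / exp (lam * \<tau>))) powr (- \<beta>))"

definition solves_scheme ::
  "real \<Rightarrow> real \<Rightarrow> real \<Rightarrow> real \<Rightarrow> real \<Rightarrow> real \<Rightarrow> nat \<Rightarrow> nat \<Rightarrow> (real \<Rightarrow> real \<Rightarrow> real)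
     \<Rightarrow> (nat \<Rightarrow> nat \<Rightarrow> real) \<Rightarrow> bool" where
  "solves_scheme \<alpha> \<gamma> \<beta> lam h \<tau> M N f u \<longleftrightarrow>
     (\<forall>n\<le>N. u n 0 = 0 \<and> u n M = 0) \<and>
     (\<forall>n<N. \<forall>i\<in>{1..M - 1}.
        u (n + 1) i - u n i =
          \<tau> powr \<gamma> / 2 *
            (\<Sum>k = 0..n. l_coeff \<beta> lam \<tau> k *
               riesz_deriv \<alpha> h M (\<lambda>j. u (n + 1 - k) j + u (n - k) j) i)
          + \<tau> * f (real i * h) ((real n + 1/2) * \<tau>))"

text \<open>
  The remaining lemmas confirm the closed form of \<open>l_coeff\<close>; \<open>g\<^sub>m\<close> is
  the Taylor coefficient of \<open>(1 - z) powr (- \<beta>)\<close>.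
\<close>

definition g_coeff :: "real \<Rightarrow> nat \<Rightarrow> real" where
  "g_coeff \<beta> = taylor_coeff (\<lambda>z. (1 - z) powr (- \<beta>))"

lemma taylor_coeff_has_fps_expansion:
  assumes "F has_fps_expansion A"
  shows "taylor_coeff F k = fps_nth A k"
proof -
  have *: "(deriv ^^ k) F has_fps_expansion (fps_deriv ^^ k) A" for k
    by (induction k) (use assms in \<open>auto intro: has_fps_expansion_deriv\<close>)
  have "(deriv ^^ k) F 0 = fps_nth ((fps_deriv ^^ k) A) 0"
    using *[of k] by (auto simp: has_fps_expansion_def eval_fps_at_0 dest!: eventually_nhds_x_imp_x)
  also have "\<dots> = fact k * fps_nth A k"
    by (simp add: fps_0th_higher_deriv)
  finally show ?thesis
    by (simp add: taylor_coeff_def)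
qed

lemma powr_affine_has_fps_expansion:
  fixes c a :: real
  shows "(\<lambda>z. (1 - c * z) powr a) has_fps_expansion Abs_fps (\<lambda>n. (a gchoose n) * (- c) ^ n)"
proof (rule has_fps_expansionI)
  have "eventually (\<lambda>z. z \<in> ball 0 (1 / (\<bar>c\<bar> + 1))) (nhds (0::real))"
    by (intro eventually_nhds_in_open) (auto simp: add_nonneg_pos)
  then show "eventually (\<lambda>z. (\<lambda>n. fps_nth (Abs_fps (\<lambda>n. (a gchoose n) * (- c) ^ n)) n * z ^ n)
               sums (1 - c * z) powr a) (nhds 0)"
  proof eventually_elim
    case (elim z)
    then have "\<bar>z\<bar> * (\<bar>c\<bar> + 1) < 1"
      by (simp add: field_simps)
    moreover have "\<bar>z\<bar> * \<bar>c\<bar> \<le> \<bar>z\<bar> * (\<bar>c\<bar> + 1)"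
      by (intro mult_left_mono) auto
    ultimately have "\<bar>- (c * z)\<bar> < 1"
      by (simp add: abs_mult mult.commute)
    from gen_binomial_real[OF this, of a] show ?case
      by (simp add: power_mult_distrib[symmetric] mult.assoc)
  qed
qed

lemma g_coeff_eq: "g_coeff \<beta> m = (- 1) ^ m * ((- \<beta>) gchoose m)"
  unfolding g_coeff_def
  using taylor_coeff_has_fps_expansion[OF powr_affine_has_fps_expansion[of 1 "- \<beta>"], of m]
  by simp

lemma l_coeff_eq:
  "l_coeff \<beta> lam \<tau> k =
     exp (- (lam * real k * \<tau>)) * (3/2) powr (- \<beta>)
       * (\<Sum>m = 0..k. (1/3) ^ m * g_coeff \<beta> m * g_coeff \<beta> (k - m))"
proof -
  define c where "c = exp (- (lam * \<tau>))"
  define A where "A = Abs_fps (\<lambda>n. ((- \<beta>) gchoose n) * (- (c / 3)) ^ n)"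
  define B where "B = Abs_fps (\<lambda>n. ((- \<beta>) gchoose n) * (- c) ^ n)"
  let ?r = "(3/2) powr (- \<beta>) :: real"
  have A: "(\<lambda>z. (1 - c / 3 * z) powr (- \<beta>)) has_fps_expansion A"
    unfolding A_def by (rule powr_affine_has_fps_expansion)
  have B: "(\<lambda>z. (1 - c * z) powr (- \<beta>)) has_fps_expansion B"
    unfolding B_def by (rule powr_affine_has_fps_expansion)
  have "(\<lambda>z. ?r * ((1 - c / 3 * z) powr (- \<beta>) * (1 - c * z) powr (- \<beta>)))
          has_fps_expansion fps_const ?r * (A * B)"
    by (intro has_fps_expansion_cmult_left has_fps_expansion_mult A B)
  moreover have "?r * ((1 - c / 3 * z) powr (- \<beta>) * (1 - c * z) powr (- \<beta>)) =
      (1 - z / exp (lam * \<tau>)) powr (- \<beta>) * (1 + 1/2 * (1 - z / exp (lam * \<tau>))) powr (- \<beta>)"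
    for z :: real
  proof -
    have c: "z / exp (lam * \<tau>) = c * z"
      by (simp add: c_def exp_minus field_simps)
    have "1 + 1/2 * (1 - c * z) = 3/2 * (1 - c / 3 * z)" by (simp add: field_simps)
    also have "\<dots> powr (- \<beta>) = ?r * (1 - c / 3 * z) powr (- \<beta>)"
      by (rule powr_mult)
    finally show ?thesis unfolding c by simp
  qed
  ultimately have "(\<lambda>z. (1 - z / exp (lam * \<tau>)) powr (- \<beta>)
        * (1 + 1/2 * (1 - z / exp (lam * \<tau>))) powr (- \<beta>)) has_fps_expansion fps_const ?r * (A * B)"
    by simp
  from taylor_coeff_has_fps_expansion[OF this, of k]
  have "l_coeff \<beta> lam \<tau> k = ?r * (\<Sum>m = 0..k. fps_nth A m * fps_nth B (k - m))"
    unfolding l_coeff_def fps_mult_left_const_nth by (simp add: fps_mult_nth)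
  also have "(\<Sum>m = 0..k. fps_nth A m * fps_nth B (k - m)) =
      (\<Sum>m = 0..k. c ^ k * ((1/3) ^ m * g_coeff \<beta> m * g_coeff \<beta> (k - m)))"
  proof (rule sum.cong)
    fix m assume "m \<in> {0..k}"
    then have "c ^ k = c ^ m * c ^ (k - m)"
      by (simp add: power_add[symmetric])
    moreover have "(- (c / 3)) ^ m = (- 1) ^ m * c ^ m * (1/3) ^ m"
      by (simp add: power_mult_distrib[symmetric])
    moreover have "(- c) ^ (k - m) = (- 1) ^ (k - m) * c ^ (k - m)"
      by (simp add: power_mult_distrib[symmetric])
    ultimately show "fps_nth A m * fps_nth B (k - m) =
        c ^ k * ((1/3) ^ m * g_coeff \<beta> m * g_coeff \<beta> (k - m))"
      by (simp only: A_def B_def g_coeff_eq fps_nth_Abs_fps mult_ac)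
  qed simp
  also have "\<dots> = c ^ k * (\<Sum>m = 0..k. (1/3) ^ m * g_coeff \<beta> m * g_coeff \<beta> (k - m))"
    by (simp only: sum_distrib_left)
  also have "c ^ k = exp (- (lam * real k * \<tau>))"
    by (simp add: c_def exp_of_nat_mult[symmetric] mult_ac)
  finally show ?thesis by (simp only: mult_ac)
qed

end

theory Submission
  imports Defs
begin

text \<open>
  The error \<open>e\<^sup>n\<close> solves the scheme without source.  Put \<open>s\<^sup>n = e\<^sup>n\<^sup>+\<^sup>1 + e\<^sup>n\<close> and test the equation for
  \<open>e\<^sup>n\<^sup>+\<^sup>1 - e\<^sup>n\<close> with \<open>s\<^sup>n\<close>: the left side is the increment of the squared norm, and summation over
  the time levels below \<open>n\<close> gives
  \<open>\<parallel>e\<^sup>n\<parallel>\<^sup>2 - \<parallel>e\<^sup>0\<parallel>\<^sup>2 = - C (\<Sum>q<n. \<Sum>k\<le>q. l\<^sub>k B(s\<^sup>q\<^sup>-\<^sup>k, s\<^sup>q))\<close> with \<open>C \<ge> 0\<close>, where \<open>B\<close> is the bilinear form of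
  \<open>- W\<close> and \<open>W\<close> is the matrix of the weights.  It remains to see that the double sum is nonnegative, whatever
  the vectors \<open>s\<^sup>q\<close>, for which a fact about space and one about time are combined.

  In space, \<open>B\<close> is positive semidefinite (\<open>riesz_quadratic_form_nonpos\<close>).  With \<open>p = 3 - \<alpha>\<close>, which
  lies in \<open>[1, 2)\<close>, the weights away from the diagonal are fourth differences of \<open>t powr p\<close>, and their partial
  sums are third differences.  The derivatives \<open>p (p - 1) \<dots> (p - k + 1) t powr (p - k)\<close> are nonpositive
  for \<open>k = 3\<close> and nonnegative for \<open>k = 4\<close>.  Together with a direct estimate for the nearest neighbours and for
  the points next to the boundary this shows that the symmetric matrix \<open>W\<close> has nonnegative entries off the
  diagonal and nonpositive row sums; by diagonal dominance it is negative semidefinite.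

  In time, the coefficients \<open>l\<^sub>k\<close> form a positive real kernel (\<open>l_coeff_kernel_nonneg\<close>): their generating
  function is \<open>D(w)\<^sup>-\<^sup>\<beta>\<close>, where \<open>D(w) = (1 - w)(3 - w)/2\<close> is the symbol of the second order backward difference
  formula and \<open>w = exp(- \<lambda>\<tau>) z\<close>.  This formula is A-stable, that is, \<open>Re D \<ge> 0\<close> on the unit disc; hence the
  argument of \<open>D\<close> is at most \<open>\<pi>/2\<close> in modulus, and the same holds for its power with exponent \<open>- \<beta>\<close>
  since \<open>0 \<le> \<beta> \<le> 1\<close>.

  The two are joined by \<open>positive_real_kernel\<close>: if the power series \<open>\<Sum>k. c\<^sub>k z\<^sup>k\<close> with real coefficients has
  nonnegative real part on the disc, then \<open>\<Sum>q<n. \<Sum>k\<le>q. c\<^sub>k G(q-k, q) \<ge> 0\<close> for each symmetric positive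
  semidefinite matrix \<open>G\<close>.  Indeed, on circles of radius tending to \<open>1\<close> the sum is the limit of the means of the product of
  two nonnegative functions, the real part of the series and \<open>\<Sum>q<n. \<Sum>m<n. G(m, q) cos((m-q)\<theta>)\<close>.
  Here \<open>G\<close> is the Gram matrix of the vectors \<open>s\<^sup>m\<close> with respect to \<open>B\<close>, so that no diagonalization of \<open>W\<close> is involved.
\<close>

section \<open>Differences of powers\<close>

definition fwd_diff :: "(real \<Rightarrow> real) \<Rightarrow> real \<Rightarrow> real" where
  "fwd_diff f x = f (x + 1) - f x"

lemma has_derivative_fwd_diff_iter:
  assumes "\<And>y. y > 0 \<Longrightarrow> (f has_real_derivative f' y) (at y)" "x > 0"
  shows "((fwd_diff ^^ k) f has_real_derivative (fwd_diff ^^ k) f' x) (at x)"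
  using assms(2)
proof (induction k arbitrary: x)
  case 0
  then show ?case using assms(1) by simp
next
  case (Suc k)
  have "((\<lambda>y. (fwd_diff ^^ k) f (y + 1)) has_real_derivative (fwd_diff ^^ k) f' (x + 1)) (at x)"
    using Suc.IH[of "x + 1"] Suc.prems by (simp add: DERIV_shift)
  from DERIV_diff[OF this Suc.IH[OF Suc.prems]] show ?case
    by (simp add: fwd_diff_def[abs_def])
qed

lemma continuous_on_fwd_diff_iter:
  assumes "continuous_on {0..} f"
  shows "continuous_on {0..} ((fwd_diff ^^ k) f)"
proof (induction k)
  case (Suc k)
  have "continuous_on {0..} (\<lambda>x. (fwd_diff ^^ k) f (x + 1))"
    by (rule continuous_on_compose2[OF Suc]) (auto intro!: continuous_intros)
  with Suc show ?case
    by (simp add: fwd_diff_def[abs_def] continuous_on_diff)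
qed (use assms in simp)

lemma fwd_diff_iter_cmult:
  "(fwd_diff ^^ k) (\<lambda>t. c * f t) x = c * (fwd_diff ^^ k) f x"
  by (induction k arbitrary: x) (simp_all add: fwd_diff_def right_diff_distrib)

text \<open>
  Mean value theorem for differences of order \<open>k\<close>: the operator \<open>fwd_diff\<close> commutes with differentiation, so one
  difference at a time is traded for one derivative.  The point \<open>x = 0\<close> is included for \<open>p > 0\<close>; there the
  function may fail to be differentiable, but the mean value theorem needs only continuity at the end
  of the interval and moves on to a point \<open>z > 0\<close>.
\<close>
lemma fwd_diff_iter_powr:
  assumes "x \<ge> 0" "x > 0 \<or> p > 0"
  shows "\<exists>\<xi>\<ge>x. (fwd_diff ^^ k) (\<lambda>t. t powr p) x = (\<Prod>i<k. p - real i) * \<xi> powr (p - real k)"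
  using assms
proof (induction k arbitrary: x p)
  case 0
  then show ?case by auto
next
  case (Suc k)
  let ?g = "(fwd_diff ^^ k) (\<lambda>t. t powr p)"
  have deriv: "(?g has_real_derivative p * (fwd_diff ^^ k) (\<lambda>t. t powr (p - 1)) y) (at y)"
    if "y > 0" for y
    using has_derivative_fwd_diff_iter[of "\<lambda>t. t powr p" "\<lambda>t. p * t powr (p - 1)" y k] that
    by (simp add: fwd_diff_iter_cmult has_real_derivative_powr)
  have cont: "continuous_on {x..x + 1} ?g"
  proof (cases "x > 0")
    case True
    then show ?thesis
      by (auto intro!: continuous_at_imp_continuous_on DERIV_isCont[OF deriv])
  next
    case False
    with Suc.prems have "continuous_on {0..} (\<lambda>t::real. t powr p)"
      by (intro continuous_on_powr') (auto intro!: continuous_intros)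
    from continuous_on_subset[OF continuous_on_fwd_diff_iter[OF this]] Suc.prems show ?thesis
      by auto
  qed
  obtain z where z: "x < z" "z < x + 1"
      and eq: "?g (x + 1) - ?g x = p * (fwd_diff ^^ k) (\<lambda>t. t powr (p - 1)) z"
  proof -
    have "?g differentiable (at y)" if "x < y" for y
      using deriv[of y] that Suc.prems(1) by (auto simp: real_differentiable_def)
    with cont obtain l z where "x < z" "z < x + 1" "(?g has_real_derivative l) (at z)"
        "?g (x + 1) - ?g x = l"
      using MVT[of x "x + 1" ?g] by auto
    moreover from this have "l = p * (fwd_diff ^^ k) (\<lambda>t. t powr (p - 1)) z"
      using deriv[of z] Suc.prems(1) by (auto intro: DERIV_unique)
    ultimately show ?thesis using that by auto
  qed
  obtain \<xi> where \<xi>: "\<xi> \<ge> z"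
      "(fwd_diff ^^ k) (\<lambda>t. t powr (p - 1)) z = (\<Prod>i<k. p - 1 - real i) * \<xi> powr (p - 1 - real k)"
    using Suc.IH[of z "p - 1"] z Suc.prems(1) by auto
  have "(\<Prod>i<Suc k. p - real i) = p * (\<Prod>i<k. p - 1 - real i)"
    by (simp add: prod.lessThan_Suc_shift diff_diff_eq del: prod.lessThan_Suc)
  moreover have "(fwd_diff ^^ Suc k) (\<lambda>t. t powr p) x = ?g (x + 1) - ?g x"
    by (simp add: fwd_diff_def)
  ultimately show ?case
    using eq \<xi> z by (intro exI[of _ \<xi>]) (simp add: algebra_simps)
qed

lemma fourth_diff_powr_nonneg:
  fixes p x :: real
  assumes "1 \<le> p" "p < 2" "x \<ge> 0"
  shows "0 \<le> (x + 4) powr p - 4 * (x + 3) powr p + 6 * (x + 2) powr p - 4 * (x + 1) powr p + x powr p"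
proof -
  obtain \<xi> where "(fwd_diff ^^ 4) (\<lambda>t. t powr p) x = (\<Prod>i<4. p - real i) * \<xi> powr (p - real 4)"
    using fwd_diff_iter_powr[of x p 4] assms by auto
  moreover have "(\<Prod>i<4. p - real i) = (p * (p - 1)) * ((2 - p) * (3 - p))"
    by (simp add: eval_nat_numeral) (simp add: algebra_simps)
  moreover have "\<dots> \<ge> 0"
    using assms by (intro mult_nonneg_nonneg) auto
  ultimately have "(fwd_diff ^^ 4) (\<lambda>t. t powr p) x \<ge> 0"
    by simp
  then show ?thesis
    by (simp add: eval_nat_numeral fwd_diff_def) (simp add: algebra_simps)
qed

lemma third_diff_powr_nonpos:
  fixes p x :: real
  assumes "1 \<le> p" "p < 2" "x \<ge> 0"
  shows "(x + 3) powr p - 3 * (x + 2) powr p + 3 * (x + 1) powr p - x powr p \<le> 0"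
proof -
  obtain \<xi> where "(fwd_diff ^^ 3) (\<lambda>t. t powr p) x = (\<Prod>i<3. p - real i) * \<xi> powr (p - real 3)"
    using fwd_diff_iter_powr[of x p 3] assms by auto
  moreover have "(\<Prod>i<3. p - real i) = - (p * (p - 1) * (2 - p))"
    by (simp add: eval_nat_numeral) (simp add: algebra_simps)
  moreover have "p * (p - 1) * (2 - p) \<ge> 0"
    using assms by (intro mult_nonneg_nonneg) auto
  ultimately have "(fwd_diff ^^ 3) (\<lambda>t. t powr p) x \<le> 0"
    by simp
  then show ?thesis
    by (simp add: eval_nat_numeral fwd_diff_def) (simp add: algebra_simps)
qed

text \<open>
  This is the coefficient of the nearest neighbours, where the fourth difference of \<open>\<bar>t\<bar> powr p\<close> straddles the
  origin and the sign of the fourth derivative says nothing.  The expression vanishes at \<open>p = 2\<close> and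
  decreases in \<open>p\<close>: as \<open>3 powr p \<le> (9/4) 2 powr p\<close> for \<open>p \<le> 2\<close>, its derivative is nonpositive as soon as
  \<open>9 ln 3 \<le> 16 ln 2\<close>, that is, \<open>3\<^sup>9 \<le> 2\<^sup>1\<^sup>6\<close>.
\<close>
lemma seven_minus_four_powr_nonneg:
  fixes p :: real
  assumes "1 \<le> p" "p \<le> 2"
  shows "0 \<le> 7 - 4 * 2 powr p + 3 powr p"
proof -
  define g where "g = (\<lambda>p::real. 7 - 4 * 2 powr p + 3 powr p)"
  have "g 2 \<le> g p"
  proof (rule DERIV_nonpos_imp_nonincreasing[of p 2 g])
    fix x assume x: "p \<le> x" "x \<le> (2::real)"
    have "ln (3 ^ 9 :: real) \<le> ln (2 ^ 16)" by simp
    then have ln: "9 * ln 3 \<le> (16::real) * ln 2"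
      using ln_realpow[of 3 9] ln_realpow[of 2 16] by linarith
    have "(3::real) powr x = (3 / 2) powr x * 2 powr x"
      by (simp flip: powr_mult)
    also have "\<dots> \<le> (3 / 2) powr 2 * 2 powr x"
      using x by (intro mult_right_mono powr_mono) auto
    also have "\<dots> = 9 / 4 * 2 powr x" by (simp add: power2_eq_square)
    finally have "3 powr x * ln 3 \<le> 9 / 4 * 2 powr x * ln (3::real)"
      by (intro mult_right_mono) auto
    also have "\<dots> \<le> 2 powr x * (4 * ln 2)"
      using mult_left_mono[OF ln, of "2 powr x / 4"] by simp
    finally have "- (4 * (2 powr x * ln 2)) + 3 powr x * ln 3 \<le> (0::real)" by simp
    moreover have "(g has_real_derivative - (4 * (2 powr x * ln 2)) + 3 powr x * ln 3) (at x)"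
      unfolding g_def by (auto intro!: derivative_eq_intros)
    ultimately show "\<exists>y. (g has_real_derivative y) (at x) \<and> y \<le> 0" by blast
  qed (use assms in auto)
  moreover have "g 2 = 0" by (simp add: g_def)
  ultimately show ?thesis by (simp add: g_def)
qed

section \<open>The Riesz matrix is negative semidefinite\<close>

definition riesz_offdiag :: "real \<Rightarrow> nat \<Rightarrow> real" where
  "riesz_offdiag \<alpha> d = (if d = 1 then riesz_w \<alpha> 0 + riesz_w \<alpha> 2 else riesz_w \<alpha> (d + 1))"

lemma riesz_weight_eq:
  "riesz_weight \<alpha> i j = (if i = j then 2 * riesz_w \<alpha> 1 else riesz_offdiag \<alpha> (nat \<bar>int i - int j\<bar>))"
  by (auto simp: riesz_weight_def riesz_offdiag_def Let_def)

lemma riesz_w_nonneg: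
  assumes "1 < \<alpha>" "\<alpha> \<le> 2" "m \<ge> 3"
  shows "riesz_w \<alpha> m \<ge> 0"
  using fourth_diff_powr_nonneg[of "3 - \<alpha>" "real m - 3"] assms
  by (simp add: riesz_w_def algebra_simps)

lemma two_powr_five_minus: "(2::real) powr (5 - \<alpha>) = 4 * 2 powr (3 - \<alpha>)"
  using powr_add[of 2 2 "3 - \<alpha>"] by simp

lemma riesz_offdiag_nonneg:
  assumes "1 < \<alpha>" "\<alpha> \<le> 2" "d \<ge> 1"
  shows "riesz_offdiag \<alpha> d \<ge> 0"
proof (cases "d = 1")
  case True
  then show ?thesis
    using seven_minus_four_powr_nonneg[of "3 - \<alpha>"] assms
    by (simp add: riesz_offdiag_def riesz_w_def two_powr_five_minus)
next
  case False
  with assms show ?thesis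
    using riesz_w_nonneg[of \<alpha> "d + 1"] by (simp add: riesz_offdiag_def)
qed

text \<open>
  The half rows to the left and to the right of the diagonal, each with half of the diagonal entry,
  telescope: a sum of consecutive fourth differences is a third difference.
\<close>
lemma riesz_half_row_sum_eq:
  assumes "\<alpha> < 3"
  shows "riesz_w \<alpha> 1 + (\<Sum>d = 1..Suc K. riesz_offdiag \<alpha> d) =
      (real K + 3) powr (3 - \<alpha>) - 3 * (real K + 2) powr (3 - \<alpha>)
        + 3 * (real K + 1) powr (3 - \<alpha>) - real K powr (3 - \<alpha>)"
proof (induction K)
  case 0
  show ?case by (simp add: riesz_offdiag_def riesz_w_def two_powr_five_minus)
next
  case (Suc K)
  have "riesz_offdiag \<alpha> (Suc (Suc K)) = (real K + 4) powr (3 - \<alpha>) - 4 * (real K + 3) powr (3 - \<alpha>)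
        + 6 * (real K + 2) powr (3 - \<alpha>) - 4 * (real K + 1) powr (3 - \<alpha>) + real K powr (3 - \<alpha>)"
    by (simp add: riesz_offdiag_def riesz_w_def add_ac)
  with Suc show ?case by (simp add: add_ac)
qed

text \<open>
  The empty half row, next to the boundary, does not fit the third difference formula and is
  bounded directly by \<open>2 powr (3 - \<alpha>) \<le> 4\<close>.
\<close>
lemma riesz_half_row_sum_nonpos:
  assumes "1 < \<alpha>" "\<alpha> \<le> 2"
  shows "riesz_w \<alpha> 1 + (\<Sum>d = 1..K. riesz_offdiag \<alpha> d) \<le> 0"
proof (cases K)
  case 0
  have "(2::real) powr (3 - \<alpha>) \<le> 2 powr 2"
    using assms by (intro powr_mono) auto
  with 0 show ?thesis by (simp add: riesz_w_def)
next
  case (Suc n)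
  then show ?thesis
    using riesz_half_row_sum_eq[of \<alpha> n] third_diff_powr_nonpos[of "3 - \<alpha>" "real n"] assms
    by simp
qed

lemma riesz_row_sum_nonpos:
  assumes "1 < \<alpha>" "\<alpha> \<le> 2" "i \<in> {1..M - 1}"
  shows "(\<Sum>j = 1..M - 1. riesz_weight \<alpha> i j) \<le> 0"
proof -
  have "{1..M - 1} = {1..<i} \<union> {i} \<union> {i<..M - 1}" using assms(3) by auto
  moreover have "{1..<i} \<inter> {i<..M - 1} = {}" by auto
  ultimately have "(\<Sum>j = 1..M - 1. riesz_weight \<alpha> i j) =
      (\<Sum>j\<in>{1..<i}. riesz_weight \<alpha> i j) + riesz_weight \<alpha> i i + (\<Sum>j\<in>{i<..M - 1}. riesz_weight \<alpha> i j)"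
    by (simp add: sum.union_disjoint)
  also have "(\<Sum>j\<in>{1..<i}. riesz_weight \<alpha> i j) = (\<Sum>d = 1..i - 1. riesz_offdiag \<alpha> d)"
    by (rule sum.reindex_bij_witness[of _ "\<lambda>d. i - d" "\<lambda>j. i - j"])
       (use assms(3) in \<open>auto simp: riesz_weight_eq of_nat_diff nat_diff_distrib'\<close>)
  also have "(\<Sum>j\<in>{i<..M - 1}. riesz_weight \<alpha> i j) = (\<Sum>d = 1..M - 1 - i. riesz_offdiag \<alpha> d)"
    by (rule sum.reindex_bij_witness[of _ "\<lambda>d. i + d" "\<lambda>j. j - i"])
       (use assms(3) in \<open>auto simp: riesz_weight_eq of_nat_diff nat_diff_distrib'\<close>)
  finally show ?thesis
    using riesz_half_row_sum_nonpos[OF assms(1,2), of "i - 1"]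
          riesz_half_row_sum_nonpos[OF assms(1,2), of "M - 1 - i"]
    by (simp add: riesz_weight_eq)
qed

text \<open>
  Diagonal dominance through the identity
  \<open>2 \<Sum>\<^sub>i\<^sub>j A\<^sub>i\<^sub>j x\<^sub>i x\<^sub>j = 2 \<Sum>\<^sub>i (\<Sum>\<^sub>j A\<^sub>i\<^sub>j) x\<^sub>i\<^sup>2 - \<Sum>\<^sub>i\<^sub>j A\<^sub>i\<^sub>j (x\<^sub>i - x\<^sub>j)\<^sup>2\<close>, in whose last sum the diagonal drops out.
\<close>
lemma quadratic_form_nonpos:
  fixes A :: "'a \<Rightarrow> 'a \<Rightarrow> real"
  assumes sym: "\<And>i j. i \<in> I \<Longrightarrow> j \<in> I \<Longrightarrow> A i j = A j i"
    and offdiag: "\<And>i j. i \<in> I \<Longrightarrow> j \<in> I \<Longrightarrow> i \<noteq> j \<Longrightarrow> A i j \<ge> 0"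
    and rows: "\<And>i. i \<in> I \<Longrightarrow> (\<Sum>j\<in>I. A i j) \<le> 0"
  shows "(\<Sum>i\<in>I. \<Sum>j\<in>I. A i j * x i * x j) \<le> 0"
proof -
  let ?Q = "\<Sum>i\<in>I. \<Sum>j\<in>I. A i j * x i * x j"
  let ?R = "\<Sum>i\<in>I. \<Sum>j\<in>I. A i j * (x i)\<^sup>2"
  have swap: "(\<Sum>i\<in>I. \<Sum>j\<in>I. A i j * (x j)\<^sup>2) = ?R"
    by (subst sum.swap) (intro sum.cong refl, simp add: sym)
  have "(\<Sum>i\<in>I. \<Sum>j\<in>I. A i j * (x i - x j)\<^sup>2) =
      (\<Sum>i\<in>I. \<Sum>j\<in>I. A i j * (x i)\<^sup>2 + A i j * (x j)\<^sup>2 - 2 * (A i j * x i * x j))"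
    by (intro sum.cong refl) (simp add: power2_eq_square algebra_simps)
  also have "\<dots> = 2 * ?R - 2 * ?Q"
    by (simp add: sum.distrib sum_subtractf swap flip: sum_distrib_left)
  finally have *: "2 * ?Q = 2 * ?R - (\<Sum>i\<in>I. \<Sum>j\<in>I. A i j * (x i - x j)\<^sup>2)" by simp
  have "0 \<le> A i j * (x i - x j)\<^sup>2" if "i \<in> I" "j \<in> I" for i j
    using offdiag that by (cases "i = j") auto
  then have "0 \<le> (\<Sum>i\<in>I. \<Sum>j\<in>I. A i j * (x i - x j)\<^sup>2)"
    by (intro sum_nonneg)
  moreover have "?R = (\<Sum>i\<in>I. (\<Sum>j\<in>I. A i j) * (x i)\<^sup>2)"
    by (simp add: sum_distrib_right)
  moreover have "\<dots> \<le> 0"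
    by (intro sum_nonpos mult_nonpos_nonneg rows) auto
  ultimately show ?thesis using * by linarith
qed

lemma riesz_quadratic_form_nonpos:
  assumes "1 < \<alpha>" "\<alpha> \<le> 2"
  shows "(\<Sum>i = 1..M - 1. \<Sum>j = 1..M - 1. riesz_weight \<alpha> i j * x i * x j) \<le> 0"
proof (rule quadratic_form_nonpos)
  show "riesz_weight \<alpha> i j = riesz_weight \<alpha> j i" for i j
    by (simp add: riesz_weight_def abs_minus_commute)
  show "riesz_weight \<alpha> i j \<ge> 0" if "i \<noteq> j" for i j
    using riesz_offdiag_nonneg[OF assms, of "nat \<bar>int i - int j\<bar>"] that
    by (simp add: riesz_weight_eq)
qed (rule riesz_row_sum_nonpos[OF assms])

section \<open>Positive real kernels\<close>

lemma sum_cos_roots_of_unity: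
  fixes k :: int
  assumes "L > 0" "\<bar>k\<bar> < int L"
  shows "(\<Sum>j<L. cos (2 * pi * real_of_int k * real j / real L)) = (if k = 0 then real L else 0)"
proof (cases "k = 0")
  case False
  define z where "z = cis (2 * pi * real_of_int k / real L)"
  have pow: "z ^ j = cis (2 * pi * real_of_int k * real j / real L)" for j
    by (simp add: z_def Complex.DeMoivre mult_ac)
  have "z ^ L = cis (2 * pi * real_of_int k)"
    unfolding pow using assms(1) by simp
  also have "\<dots> = 1"
    by (rule cis_multiple_2pi) simp
  finally have "z ^ L = 1" .
  have "z \<noteq> 1"
  proof
    assume "z = 1"
    then have "cos (2 * pi * real_of_int k / real L) = 1"
      by (simp add: z_def complex_eq_iff)
    then obtain m :: int where "2 * pi * real_of_int k / real L = of_int m * 2 * pi"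
      by (auto simp: cos_one_2pi_int)
    then have "real_of_int k = of_int m * real L"
      using assms(1) by (simp add: field_simps)
    then have "k = m * int L"
      by (metis of_int_eq_iff of_int_mult of_int_of_nat_eq)
    with assms(2) False show False
      by (cases "m = 0") (auto simp: abs_mult)
  qed
  with \<open>z ^ L = 1\<close> have "(\<Sum>j<L. z ^ j) = 0"
    by (simp add: geometric_sum)
  then have "Re (\<Sum>j<L. z ^ j) = 0" by simp
  with False show ?thesis by (simp add: pow Re_sum)
qed simp

text \<open>
  Discrete orthogonality of the cosines.  With \<open>2 K\<close> nodes, \<open>k + d\<close> and \<open>k - d\<close> are below the number of nodes in modulus, so
  that the discrete mean agrees with the mean over the circle without aliasing.
\<close>
lemma sum_cos_cos_roots_of_unity:
  fixes d :: int
  assumes "k < K" "\<bar>d\<bar> < int K"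
  shows "(\<Sum>j<2 * K. cos (real k * (2 * pi * real j / real (2 * K)))
                     * cos (real_of_int d * (2 * pi * real j / real (2 * K))))
          = real K * ((if d = int k then 1 else 0) + (if d = - int k then 1 else 0))"
proof -
  have "(\<Sum>j<2 * K. cos (real k * (2 * pi * real j / real (2 * K)))
                     * cos (real_of_int d * (2 * pi * real j / real (2 * K)))) =
     ((\<Sum>j<2 * K. cos (2 * pi * real_of_int (int k - d) * real j / real (2 * K)))
     + (\<Sum>j<2 * K. cos (2 * pi * real_of_int (int k + d) * real j / real (2 * K)))) / 2"
    unfolding sum.distrib[symmetric] sum_divide_distrib cos_times_cos
    by (intro sum.cong refl) (simp add: algebra_simps add_divide_distrib diff_divide_distrib)
  also have "\<dots> = real K * ((if d = int k then 1 else 0) + (if d = - int k then 1 else 0))"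
    using assms by (subst (1 2) sum_cos_roots_of_unity) auto
  finally show ?thesis .
qed

lemma sum_square_symmetric:
  fixes f :: "nat \<Rightarrow> nat \<Rightarrow> real"
  assumes "\<And>m q. f m q = f q m"
  shows "(\<Sum>q<n. \<Sum>m<n. f m q) = (\<Sum>q<n. f q q + 2 * (\<Sum>m<q. f m q))"
proof (induction n)
  case (Suc n)
  have "(\<Sum>q<n. f n q) = (\<Sum>m<n. f m n)" by (intro sum.cong refl assms)
  with Suc show ?case by (simp add: sum.distrib)
qed simp

text \<open>
  By the addition theorem the sum is \<open>x\<^sup>T G x + y\<^sup>T G y\<close> for the vectors \<open>x\<^sub>m = cos (m \<theta>)\<close> and \<open>y\<^sub>m = sin (m \<theta>)\<close>.
\<close>
lemma psd_cos_sum_nonneg: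
  fixes G :: "nat \<Rightarrow> nat \<Rightarrow> real"
  assumes psd: "\<And>x. (\<Sum>q<n. \<Sum>m<n. G m q * x m * x q) \<ge> 0"
  shows "(\<Sum>q<n. \<Sum>m<n. G m q * cos (real_of_int (int m - int q) * \<theta>)) \<ge> 0"
proof -
  have "G m q * cos (real_of_int (int m - int q) * \<theta>) =
      G m q * cos (real m * \<theta>) * cos (real q * \<theta>) + G m q * sin (real m * \<theta>) * sin (real q * \<theta>)"
    for m q
    by (simp add: left_diff_distrib cos_diff algebra_simps)
  then show ?thesis
    using psd[of "\<lambda>m. cos (real m * \<theta>)"] psd[of "\<lambda>m. sin (real m * \<theta>)"]
    by (simp add: sum.distrib)
qed

text \<open>
  The nonnegative function \<open>(S + \<epsilon>) H\<close>, with the cosine polynomial \<open>S(\<theta>) = \<Sum>k<K. c\<^sub>k cos (k \<theta>)\<close> and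
  \<open>H(\<theta>) = \<Sum>q<n. \<Sum>m<n. G(m, q) cos ((m - q) \<theta>)\<close>, is averaged over the roots of unity of order \<open>2 K\<close>.  By orthogonality the mean of \<open>S H\<close>
  picks out \<open>c\<^sub>0\<close> on the diagonal of \<open>G\<close> and \<open>c\<^sub>d / 2\<close> on its \<open>d\<close>-th side diagonals, which add up to the kernel sum by
  symmetry of \<open>G\<close>; the mean of \<open>\<epsilon> H\<close> is \<open>\<epsilon>\<close> times the trace.  The slack \<open>\<epsilon>\<close> is there to absorb the tail of an
  infinite series cut off at \<open>K\<close>.
\<close>
lemma cosine_polynomial_kernel:
  fixes G :: "nat \<Rightarrow> nat \<Rightarrow> real" and c :: "nat \<Rightarrow> real"
  assumes sym: "\<And>m q. G m q = G q m"
    and psd: "\<And>x. (\<Sum>q<n. \<Sum>m<n. G m q * x m * x q) \<ge> 0"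
    and lower: "\<And>\<theta>. (\<Sum>k<K. c k * cos (real k * \<theta>)) \<ge> - \<epsilon>"
    and "n \<le> K" "K > 0"
  shows "(\<Sum>q<n. \<Sum>k\<le>q. c k * G (q - k) q) \<ge> - \<epsilon> * (\<Sum>q<n. G q q)"
proof -
  define \<theta> where "\<theta> j = 2 * pi * real j / real (2 * K)" for j
  define S where "S t = (\<Sum>k<K. c k * cos (real k * t))" for t
  define H where "H t = (\<Sum>q<n. \<Sum>m<n. G m q * cos (real_of_int (int m - int q) * t))" for t
  define avg where "avg F = (\<Sum>j<2 * K. F (\<theta> j)) / real (2 * K)" for F :: "real \<Rightarrow> real"
  define e where "e d = (if d = 0 then c 0 else c (nat \<bar>d\<bar>) / 2)" for d
  have avg_sum: "avg (\<lambda>t. \<Sum>i\<in>I. F i t) = (\<Sum>i\<in>I. avg (F i))" for I :: "nat set" and F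
    unfolding avg_def by (subst sum.swap) (simp add: sum_divide_distrib)
  have avg_cmult: "avg (\<lambda>t. a * F t) = a * avg F" for a F
    by (simp add: avg_def sum_distrib_left)
  have avg_add: "avg (\<lambda>t. F t + F' t) = avg F + avg F'" for F F'
    by (simp add: avg_def sum.distrib add_divide_distrib)
  have avg_cos: "avg (\<lambda>t. cos (real k * t) * cos (real_of_int d * t)) =
      ((if d = int k then 1 else 0) + (if d = - int k then 1 else 0)) / 2"
    if "k < K" "\<bar>d\<bar> < int K" for k d
    using sum_cos_cos_roots_of_unity[OF that] \<open>K > 0\<close> unfolding avg_def \<theta>_def by simp
  have avg_cos1: "avg (\<lambda>t. cos (real_of_int d * t)) = (if d = 0 then 1 else 0)"
    if "\<bar>d\<bar> < int K" for d
    using avg_cos[of 0 d] that \<open>K > 0\<close> by simp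
  have avg_S: "avg (\<lambda>t. S t * cos (real_of_int d * t)) = e d" if d: "\<bar>d\<bar> < int K" for d
  proof -
    have "avg (\<lambda>t. S t * cos (real_of_int d * t)) =
        (\<Sum>k<K. c k * avg (\<lambda>t. cos (real k * t) * cos (real_of_int d * t)))"
      by (simp add: S_def sum_distrib_right avg_sum mult.assoc avg_cmult)
    also have "\<dots> = (\<Sum>k<K. if k = nat \<bar>d\<bar> then e d else 0)"
      by (intro sum.cong refl) (use d in \<open>auto simp: avg_cos e_def\<close>)
    also have "\<dots> = e d"
      using d by (simp add: nat_less_iff)
    finally show ?thesis .
  qed
  have small: "\<bar>int m - int q\<bar> < int K" if "m < n" "q < n" for m q
    using that \<open>n \<le> K\<close> by auto
  have "0 \<le> avg (\<lambda>t. (S t + \<epsilon>) * H t)"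
    unfolding avg_def
  proof (intro divide_nonneg_nonneg sum_nonneg mult_nonneg_nonneg)
    show "0 \<le> S (\<theta> j) + \<epsilon>" for j
      using lower[of "\<theta> j"] by (simp add: S_def)
    show "0 \<le> H (\<theta> j)" for j
      unfolding H_def by (rule psd_cos_sum_nonneg[OF psd])
  qed auto
  also have "(\<lambda>t. (S t + \<epsilon>) * H t) = (\<lambda>t. (\<Sum>q<n. \<Sum>m<n. G m q * (S t * cos (real_of_int (int m - int q) * t)))
      + \<epsilon> * (\<Sum>q<n. \<Sum>m<n. G m q * cos (real_of_int (int m - int q) * t)))"
    by (simp add: H_def distrib_right distrib_left sum.distrib sum_distrib_left mult_ac)
  also have "avg \<dots> = (\<Sum>q<n. \<Sum>m<n. G m q * e (int m - int q))
      + \<epsilon> * (\<Sum>q<n. \<Sum>m<n. G m q * (if m = q then 1 else 0))"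
    by (simp add: avg_add avg_cmult avg_sum avg_S avg_cos1 small del: of_int_diff cong: sum.cong_simp)
  also have "(\<Sum>q<n. \<Sum>m<n. G m q * (if m = q then 1 else 0)) = (\<Sum>q<n. G q q)"
    by (intro sum.cong refl) (simp add: if_distrib[of "(*) _"] cong: if_cong)
  also have "(\<Sum>q<n. \<Sum>m<n. G m q * e (int m - int q)) =
      (\<Sum>q<n. G q q * c 0 + (\<Sum>m<q. c (q - m) * G m q))"
  proof (subst sum_square_symmetric)
    show "G m q * e (int m - int q) = G q m * e (int q - int m)" for m q
      by (simp add: sym[of m q] e_def abs_minus_commute)
    show "(\<Sum>q<n. G q q * e (int q - int q) + 2 * (\<Sum>m<q. G m q * e (int m - int q))) =
        (\<Sum>q<n. G q q * c 0 + (\<Sum>m<q. c (q - m) * G m q))"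
      by (auto simp: e_def sum_distrib_left nat_diff_distrib' of_nat_diff mult.commute
          intro!: sum.cong)
  qed
  also have "\<dots> = (\<Sum>q<n. \<Sum>k\<le>q. c k * G (q - k) q)"
  proof (intro sum.cong refl)
    fix q
    have "(\<Sum>k\<le>q. c k * G (q - k) q) = (\<Sum>m\<le>q. c (q - m) * G m q)"
      by (rule sum.reindex_bij_witness[of _ "\<lambda>m. q - m" "\<lambda>m. q - m"]) auto
    then show "G q q * c 0 + (\<Sum>m<q. c (q - m) * G m q) = (\<Sum>k\<le>q. c k * G (q - k) q)"
      by (simp add: lessThan_Suc_atMost[symmetric] mult.commute)
  qed
  finally show ?thesis by simp
qed

text \<open>
  The series cut off at \<open>K\<close> is bounded below by minus the tail \<open>\<epsilon> K = \<Sum>k\<ge>K. \<bar>c\<^sub>k\<bar>\<close>, which tends to \<open>0\<close>.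
\<close>
lemma absolutely_summable_positive_real_kernel:
  fixes G :: "nat \<Rightarrow> nat \<Rightarrow> real" and c :: "nat \<Rightarrow> real"
  assumes sym: "\<And>m q. G m q = G q m"
    and psd: "\<And>x. (\<Sum>q<n. \<Sum>m<n. G m q * x m * x q) \<ge> 0"
    and summable: "summable (\<lambda>k. \<bar>c k\<bar>)"
    and nonneg: "\<And>\<theta>. (\<Sum>k. c k * cos (real k * \<theta>)) \<ge> 0"
  shows "(\<Sum>q<n. \<Sum>k\<le>q. c k * G (q - k) q) \<ge> 0"
proof -
  define \<epsilon> where "\<epsilon> K = (\<Sum>k. \<bar>c (k + K)\<bar>)" for K
  have lower: "(\<Sum>k<K. c k * cos (real k * \<theta>)) \<ge> - \<epsilon> K" for K \<theta>
  proof -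
    have le: "\<bar>c k * cos (real k * \<theta>)\<bar> \<le> \<bar>c k\<bar>" for k
      by (simp add: abs_mult mult_left_le)
    have s: "summable (\<lambda>k. \<bar>c k * cos (real k * \<theta>)\<bar>)"
      by (rule summable_comparison_test'[OF summable, of 0]) (use le in auto)
    have "\<bar>\<Sum>k. c (k + K) * cos (real (k + K) * \<theta>)\<bar> \<le> (\<Sum>k. \<bar>c (k + K) * cos (real (k + K) * \<theta>)\<bar>)"
      using summable_ignore_initial_segment[OF s, of K] by (rule summable_rabs)
    also have "\<dots> \<le> \<epsilon> K"
      unfolding \<epsilon>_def using le summable_ignore_initial_segment[OF s, of K]
        summable_ignore_initial_segment[OF summable, of K] by (intro suminf_le)
    finally show ?thesis
      using suminf_split_initial_segment[OF summable_rabs_cancel[OF s], of K] nonneg[of \<theta>] by linarith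
  qed
  have "\<epsilon> \<longlonglongrightarrow> 0"
    unfolding \<epsilon>_def using suminf_exist_split2[OF summable] by simp
  then have "(\<lambda>K. - \<epsilon> K * (\<Sum>q<n. G q q)) \<longlonglongrightarrow> - 0 * (\<Sum>q<n. G q q)"
    by (intro tendsto_intros)
  moreover have "eventually (\<lambda>K. - \<epsilon> K * (\<Sum>q<n. G q q) \<le> (\<Sum>q<n. \<Sum>k\<le>q. c k * G (q - k) q)) sequentially"
    using eventually_ge_at_top[of n] eventually_gt_at_top[of 0]
    by eventually_elim (rule cosine_polynomial_kernel[OF sym psd lower])
  ultimately show ?thesis
    using tendsto_upperbound[of _ _ sequentially] by fastforce
qed

text \<open>
  The coefficients need not be summable on the unit circle itself, so the previous lemma is applied
  on circles of radius \<open>\<rho> < 1\<close>; the conclusion involves finitely many coefficients only and survives \<open>\<rho> \<rightarrow> 1\<close>.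
\<close>
lemma positive_real_kernel:
  fixes G :: "nat \<Rightarrow> nat \<Rightarrow> real" and c :: "nat \<Rightarrow> real" and F :: "complex \<Rightarrow> complex"
  assumes sym: "\<And>m q. G m q = G q m"
    and psd: "\<And>x. (\<Sum>q<n. \<Sum>m<n. G m q * x m * x q) \<ge> 0"
    and sums: "\<And>z. norm z < 1 \<Longrightarrow> (\<lambda>k. of_real (c k) * z ^ k) sums F z"
    and Re_F: "\<And>z. norm z < 1 \<Longrightarrow> Re (F z) \<ge> 0"
  shows "(\<Sum>q<n. \<Sum>k\<le>q. c k * G (q - k) q) \<ge> 0"
proof -
  have *: "(\<Sum>q<n. \<Sum>k\<le>q. c k * \<rho> ^ k * G (q - k) q) \<ge> 0" if \<rho>: "0 < \<rho>" "\<rho> < 1" for \<rho> :: real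
  proof (rule absolutely_summable_positive_real_kernel[OF sym psd])
    \<comment> \<open>Convergence at \<open>\<sigma>\<close> strictly between \<open>\<rho>\<close> and \<open>1\<close> gives absolute convergence at \<open>\<rho>\<close>.\<close>
    define \<sigma> where "\<sigma> = (\<rho> + 1) / 2"
    have \<sigma>: "\<rho> < \<sigma>" "\<sigma> < 1" "\<sigma> > 0" using \<rho> by (auto simp: \<sigma>_def)
    have "summable (\<lambda>k. norm (of_real (c k) * of_real \<rho> ^ k :: complex))"
      by (rule powser_insidea[of _ "of_real \<sigma>"])
         (use sums[of "of_real \<sigma>"] \<sigma> \<rho> in \<open>auto simp: sums_iff\<close>)
    then show "summable (\<lambda>k. \<bar>c k * \<rho> ^ k\<bar>)"
      by (simp add: norm_mult norm_power abs_mult power_abs)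
  next
    fix \<theta>
    define z where "z = of_real \<rho> * cis \<theta>"
    have z: "norm z < 1" using \<rho> by (simp add: z_def norm_mult)
    have "Re (z ^ k) = \<rho> ^ k * cos (real k * \<theta>)" for k
      by (simp add: z_def power_mult_distrib Complex.DeMoivre flip: of_real_power)
    with sums_Re[OF sums[OF z]] have "(\<lambda>k. c k * \<rho> ^ k * cos (real k * \<theta>)) sums Re (F z)"
      by (simp add: mult.assoc)
    with Re_F[OF z] show "(\<Sum>k. c k * \<rho> ^ k * cos (real k * \<theta>)) \<ge> 0"
      by (simp add: sums_iff)
  qed
  have "((\<lambda>\<rho>. \<Sum>q<n. \<Sum>k\<le>q. c k * \<rho> ^ k * G (q - k) q) \<longlongrightarrow> (\<Sum>q<n. \<Sum>k\<le>q. c k * 1 ^ k * G (q - k) q))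
      (at_left (1::real))"
    by (intro tendsto_intros)
  moreover have "eventually (\<lambda>\<rho>::real. (\<Sum>q<n. \<Sum>k\<le>q. c k * \<rho> ^ k * G (q - k) q) \<ge> 0) (at_left 1)"
    using eventually_at_left_real[of 0 1] by (auto elim!: eventually_mono intro!: *)
  ultimately show ?thesis
    using tendsto_lowerbound[of _ _ "at_left (1::real)" 0] by fastforce
qed

section \<open>The coefficients of the time discretization\<close>

text \<open>
  On the unit disc \<open>3 Re ((1 - w/3)(1 - w)) = 3 - 4 Re w + (Re w)\<^sup>2 - (Im w)\<^sup>2 \<ge> 2 (1 - Re w)\<^sup>2\<close>.  Both factors
  lie in the right half plane, so the arguments add up to some \<open>\<phi>\<close> with \<open>\<bar>\<phi>\<bar> < \<pi>\<close>; it is the argument of the product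
  and thus satisfies \<open>\<bar>\<phi>\<bar> \<le> \<pi>/2\<close>.  The power \<open>- \<beta>\<close> has argument \<open>- \<beta> \<phi>\<close>, again of modulus at most \<open>\<pi>/2\<close>.
\<close>
lemma Re_powr_bdf2_symbol_nonneg:
  fixes w :: complex and \<beta> :: real
  assumes "norm w < 1" "0 \<le> \<beta>" "\<beta> \<le> 1"
  shows "0 \<le> Re ((1 - w / 3) powr (- of_real \<beta>) * (1 - w) powr (- of_real \<beta>))"
proof -
  have Re_pos: "Re (1 - w) > 0" "Re (1 - w / 3) > 0"
    using assms(1) complex_Re_le_cmod[of w] by auto
  have "(norm w)\<^sup>2 \<le> 1\<^sup>2"
    using assms(1) by (intro power_mono) auto
  then have circle: "(Re w)\<^sup>2 + (Im w)\<^sup>2 \<le> 1"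
    by (simp add: cmod_power2)
  have "0 \<le> (1 - Re w)\<^sup>2" by simp
  with circle have "0 \<le> 3 - 4 * Re w + (Re w)\<^sup>2 - (Im w)\<^sup>2"
    by (simp add: power2_diff)
  also have "\<dots> = 3 * Re ((1 - w / 3) * (1 - w))"
    by (simp add: power2_eq_square field_simps)
  finally have Re_prod: "0 \<le> Re ((1 - w / 3) * (1 - w))" by simp
  define \<phi> where "\<phi> = Im (Ln (1 - w / 3)) + Im (Ln (1 - w))"
  have nz: "1 - w \<noteq> 0" "1 - w / 3 \<noteq> 0"
    using Re_pos by (metis less_irrefl zero_complex.sel(1))+
  have \<phi>: "\<bar>\<phi>\<bar> < pi"
    using Re_Ln_pos_lt_imp[OF Re_pos(1)] Re_Ln_pos_lt_imp[OF Re_pos(2)] by (simp add: \<phi>_def)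
  then have "Ln ((1 - w / 3) * (1 - w)) = Ln (1 - w / 3) + Ln (1 - w)"
    by (intro Ln_times_simple nz) (auto simp: \<phi>_def)
  then have "\<bar>\<phi>\<bar> \<le> pi / 2"
    using Re_Ln_pos_le[of "(1 - w / 3) * (1 - w)"] Re_prod nz by (simp add: \<phi>_def)
  then have "\<beta> * \<bar>\<phi>\<bar> \<le> 1 * (pi / 2)"
    using assms by (intro mult_mono) auto
  then have "\<bar>\<beta> * \<phi>\<bar> \<le> pi / 2"
    using assms by (simp add: abs_mult)
  then have "cos (\<beta> * \<phi>) \<ge> 0"
    by (intro cos_ge_zero) auto
  moreover have "(1 - w / 3) powr (- of_real \<beta>) * (1 - w) powr (- of_real \<beta>)
      = exp (- of_real \<beta> * (Ln (1 - w / 3) + Ln (1 - w)))"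
    using nz by (simp add: powr_def algebra_simps flip: exp_add)
  moreover have "Re \<dots> = exp (- (\<beta> * (Re (Ln (1 - w / 3)) + Re (Ln (1 - w))))) * cos (\<beta> * \<phi>)"
    by (simp only: Re_exp \<phi>_def) simp
  ultimately show ?thesis by simp
qed

lemma of_real_gchoose: "of_real (a gchoose n) = ((of_real a :: complex) gchoose n)"
  by (simp add: gbinomial_prod_rev)

lemma g_coeff_sums:
  assumes "norm w < 1"
  shows "(\<lambda>m. of_real (g_coeff \<beta> m) * w ^ m) sums (1 - w :: complex) powr (- of_real \<beta>)"
  using gen_binomial_complex[of "- w" "- of_real \<beta>"] assms
  by (simp add: g_coeff_eq of_real_gchoose power_minus[of w] mult_ac)

lemma l_coeff_sums:
  fixes z :: complex
  assumes "norm z < 1" "lam * \<tau> \<ge> 0"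
  defines "w \<equiv> of_real (exp (- (lam * \<tau>))) * z"
  shows "(\<lambda>k. of_real (l_coeff \<beta> lam \<tau> k) * z ^ k) sums
           (of_real ((3/2) powr (- \<beta>)) * ((1 - w / 3) powr (- of_real \<beta>) * (1 - w) powr (- of_real \<beta>)))"
proof -
  have "norm w \<le> 1 * norm z"
    unfolding w_def norm_mult using assms(2) by (intro mult_right_mono) auto
  with assms(1) have w: "norm w < 1" by simp
  have w3: "norm (w / 3) < 1" using w by (simp add: norm_divide)
  have summable: "summable (\<lambda>m. norm (of_real (g_coeff \<beta> m) * v ^ m))" if v: "norm v < 1" for v :: complex
  proof -
    obtain s where "norm v < s" "s < 1" using dense v by blast
    then show ?thesis
      using g_coeff_sums[of "of_real s" \<beta>] norm_ge_zero[of v]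
      by (intro powser_insidea[of _ "of_real s"]) (auto simp: sums_iff)
  qed
  have "(\<lambda>k. \<Sum>m\<le>k. of_real (g_coeff \<beta> m) * (w / 3) ^ m * (of_real (g_coeff \<beta> (k - m)) * w ^ (k - m)))
      sums ((1 - w / 3) powr (- of_real \<beta>) * (1 - w) powr (- of_real \<beta>))"
    using Cauchy_product_sums[OF summable[OF w3] summable[OF w]]
      sums_unique[OF g_coeff_sums[OF w, of \<beta>]] sums_unique[OF g_coeff_sums[OF w3, of \<beta>]] by simp
  from sums_mult[OF this, of "of_real ((3/2) powr (- \<beta>))"] show ?thesis
  proof (rule sums_cong[THEN iffD1, rotated])
    fix k
    have "exp (- (lam * real k * \<tau>)) = exp (- (lam * \<tau>)) ^ k"
      by (simp add: mult_ac flip: exp_of_nat_mult)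
    then have wk: "w ^ k = of_real (exp (- (lam * real k * \<tau>))) * z ^ k"
      by (simp add: w_def power_mult_distrib)
    have "(\<Sum>m\<le>k. of_real (g_coeff \<beta> m) * (w / 3) ^ m * (of_real (g_coeff \<beta> (k - m)) * w ^ (k - m)))
        = (\<Sum>m\<le>k. of_real ((1 / 3) ^ m * g_coeff \<beta> m * g_coeff \<beta> (k - m)) * w ^ k)"
    proof (intro sum.cong refl)
      fix m assume "m \<in> {..k}"
      then have "(w / 3) ^ m * w ^ (k - m) = of_real ((1 / 3) ^ m) * w ^ k"
        by (simp add: power_divide flip: power_add)
      then have "(of_real (g_coeff \<beta> m) * of_real (g_coeff \<beta> (k - m))) * ((w / 3) ^ m * w ^ (k - m))
        = (of_real (g_coeff \<beta> m) * of_real (g_coeff \<beta> (k - m))) * (of_real ((1 / 3) ^ m) * w ^ k)"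
        by (rule arg_cong)
      then show "of_real (g_coeff \<beta> m) * (w / 3) ^ m * (of_real (g_coeff \<beta> (k - m)) * w ^ (k - m))
        = of_real ((1 / 3) ^ m * g_coeff \<beta> m * g_coeff \<beta> (k - m)) * w ^ k"
        by (simp only: of_real_mult mult_ac)
    qed
    also have "\<dots> = of_real (\<Sum>m = 0..k. (1 / 3) ^ m * g_coeff \<beta> m * g_coeff \<beta> (k - m)) * w ^ k"
      by (simp only: of_real_sum sum_distrib_right atMost_atLeast0)
    finally show "of_real ((3/2) powr (- \<beta>)) *
        (\<Sum>m\<le>k. of_real (g_coeff \<beta> m) * (w / 3) ^ m * (of_real (g_coeff \<beta> (k - m)) * w ^ (k - m)))
        = of_real (l_coeff \<beta> lam \<tau> k) * z ^ k"
      by (simp only: l_coeff_eq wk of_real_mult mult_ac)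
  qed
qed

lemma l_coeff_kernel_nonneg:
  fixes G :: "nat \<Rightarrow> nat \<Rightarrow> real"
  assumes "0 \<le> \<beta>" "\<beta> \<le> 1" "lam * \<tau> \<ge> 0"
    and sym: "\<And>m q. G m q = G q m"
    and psd: "\<And>x. (\<Sum>q<n. \<Sum>m<n. G m q * x m * x q) \<ge> 0"
  shows "(\<Sum>q<n. \<Sum>k\<le>q. l_coeff \<beta> lam \<tau> k * G (q - k) q) \<ge> 0"
proof (rule positive_real_kernel[OF sym psd l_coeff_sums])
  fix z :: complex
  assume z: "norm z < 1"
  let ?w = "of_real (exp (- (lam * \<tau>))) * z"
  have Re_mult: "Re (of_real r * x) = r * Re x" for r x by simp
  have "norm ?w \<le> 1 * norm z"
    unfolding norm_mult using assms(3) by (intro mult_right_mono) auto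
  with z have "norm ?w < 1" by simp
  from Re_powr_bdf2_symbol_nonneg[OF this assms(1,2)]
  show "0 \<le> Re (of_real ((3/2) powr (- \<beta>)) *
      ((1 - ?w / 3) powr (- of_real \<beta>) * (1 - ?w) powr (- of_real \<beta>)))"
    by (simp only: Re_mult mult_nonneg_nonneg powr_ge_zero)
qed (use assms in auto)

section \<open>The energy argument\<close>

lemma riesz_deriv_diff:
  "riesz_deriv \<alpha> h M (\<lambda>j. x j - y j) i = riesz_deriv \<alpha> h M x i - riesz_deriv \<alpha> h M y i"
  by (simp add: riesz_deriv_def right_diff_distrib sum_subtractf)

text \<open>
  For \<open>1 < \<alpha> \<le> 2\<close> the angle \<open>\<alpha> \<pi> / 2\<close> is in the second quadrant, which makes \<open>riesz_kappa\<close> negative.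
\<close>
lemma riesz_scale_nonneg:
  assumes "1 < \<alpha>" "\<alpha> \<le> 2"
  shows "- (riesz_kappa \<alpha> / (Gamma (4 - \<alpha>) * h powr \<alpha>)) \<ge> 0"
proof -
  have "pi / 2 \<le> \<alpha> * pi / 2" "\<alpha> * pi / 2 \<le> pi"
    using assms by auto
  then have "cos (\<alpha> * pi / 2) \<le> cos (pi / 2)"
    by (intro cos_monotone_0_pi_le) auto
  then have "riesz_kappa \<alpha> \<le> 0"
    by (simp add: riesz_kappa_def divide_nonneg_nonpos)
  moreover have "Gamma (4 - \<alpha>) > 0"
    using assms by (intro Gamma_real_pos) auto
  ultimately show ?thesis
    by (simp add: divide_nonpos_nonneg)
qed

text \<open>
  The discrete analogue of the energy form of the operator \<open>(- \<Delta>)\<close> to the power \<open>\<alpha>/2\<close>, up to a positive factor.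
\<close>
definition riesz_form :: "real \<Rightarrow> nat \<Rightarrow> (nat \<Rightarrow> real) \<Rightarrow> (nat \<Rightarrow> real) \<Rightarrow> real" where
  "riesz_form \<alpha> M x y = - (\<Sum>i = 1..M - 1. \<Sum>j = 1..M - 1. riesz_weight \<alpha> i j * x j * y i)"

lemma riesz_form_commute: "riesz_form \<alpha> M x y = riesz_form \<alpha> M y x"
proof -
  have "riesz_weight \<alpha> i j = riesz_weight \<alpha> j i" for i j
    by (simp add: riesz_weight_def abs_minus_commute)
  then have "riesz_form \<alpha> M x y = - (\<Sum>i = 1..M - 1. \<Sum>j = 1..M - 1. riesz_weight \<alpha> j i * y i * x j)"
    by (simp add: riesz_form_def mult_ac)
  also have "\<dots> = riesz_form \<alpha> M y x"
    unfolding riesz_form_def by (subst sum.swap) simp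
  finally show ?thesis .
qed

lemma riesz_form_sum_left:
  "riesz_form \<alpha> M (\<lambda>i. \<Sum>m<n. c m * s m i) y = (\<Sum>m<(n::nat). c m * riesz_form \<alpha> M (s m) y)"
proof (induction n)
  case (Suc n)
  then show ?case
    by (simp add: riesz_form_def sum_distrib_left sum.distrib algebra_simps)
qed (simp add: riesz_form_def)

lemma riesz_form_gram_psd:
  fixes s :: "nat \<Rightarrow> nat \<Rightarrow> real"
  assumes "1 < \<alpha>" "\<alpha> \<le> 2"
  shows "(\<Sum>q<n. \<Sum>m<n. riesz_form \<alpha> M (s m) (s q) * x m * x q) \<ge> 0"
proof -
  define X where "X i = (\<Sum>m<n. x m * s m i)" for i
  have expand: "riesz_form \<alpha> M X y = (\<Sum>m<n. x m * riesz_form \<alpha> M (s m) y)" for y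
    unfolding X_def[abs_def] by (rule riesz_form_sum_left)
  have "riesz_form \<alpha> M X X = (\<Sum>q<n. x q * riesz_form \<alpha> M (s q) X)"
    by (rule expand)
  also have "\<dots> = (\<Sum>q<n. x q * riesz_form \<alpha> M X (s q))"
    by (simp only: riesz_form_commute[of \<alpha> M _ X])
  also have "\<dots> = (\<Sum>q<n. x q * (\<Sum>m<n. x m * riesz_form \<alpha> M (s m) (s q)))"
    by (simp only: expand)
  also have "\<dots> = (\<Sum>q<n. \<Sum>m<n. riesz_form \<alpha> M (s m) (s q) * x m * x q)"
    by (simp only: sum_distrib_left mult_ac)
  finally show ?thesis
    using riesz_quadratic_form_nonpos[OF assms, of X M] by (simp add: riesz_form_def mult_ac)
qed

theorem theorem3p1:
  fixes \<alpha> \<gamma> \<beta> lam b T h \<tau> :: real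
    and M N :: nat
    and f :: "real \<Rightarrow> real \<Rightarrow> real"
    and u v :: "nat \<Rightarrow> nat \<Rightarrow> real"
  assumes "1 < \<alpha>" and "\<alpha> \<le> 2"
    and "1 < \<gamma>" and "\<gamma> \<le> 2"
    and "lam \<ge> 0"
    and "\<beta> = \<gamma> - 1"
    and "b > 0" and "T > 0"
    and "M \<ge> 2" and "N \<ge> 1"
    and "h = b / real M" and "\<tau> = T / real N"
    and "solves_scheme \<alpha> \<gamma> \<beta> lam h \<tau> M N f u"
    and "solves_scheme \<alpha> \<gamma> \<beta> lam h \<tau> M N f v"
  shows "\<forall>n\<le>N. grid_norm h M (\<lambda>i. v n i - u n i) \<le> grid_norm h M (\<lambda>i. v 0 i - u 0 i)"
proof (intro allI impI)
  fix n assume n: "n \<le> N"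
  define e where "e k i = v k i - u k i" for k i
  define s where "s k i = e (Suc k) i + e k i" for k i
  define C where "C = \<tau> powr \<gamma> / 2 * - (riesz_kappa \<alpha> / (Gamma (4 - \<alpha>) * h powr \<alpha>))"
  have "C \<ge> 0"
    unfolding C_def using riesz_scale_nonneg[OF assms(1,2)] by (intro mult_nonneg_nonneg) auto
  have step: "e (Suc q) i - e q i =
      C * (\<Sum>k\<le>q. l_coeff \<beta> lam \<tau> k * (\<Sum>j = 1..M - 1. riesz_weight \<alpha> i j * s (q - k) j))"
    if "q < N" "i \<in> {1..M - 1}" for q i
  proof -
    let ?D = "\<lambda>w k. riesz_deriv \<alpha> h M (\<lambda>j. w (q + 1 - k) j + w (q - k) j) i"
    have "e (Suc q) i - e q i = \<tau> powr \<gamma> / 2 *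
        ((\<Sum>k = 0..q. l_coeff \<beta> lam \<tau> k * ?D v k) - (\<Sum>k = 0..q. l_coeff \<beta> lam \<tau> k * ?D u k))"
      using assms(13,14) that by (simp add: solves_scheme_def e_def algebra_simps)
    also have "\<dots> = \<tau> powr \<gamma> / 2 * (\<Sum>k\<le>q. l_coeff \<beta> lam \<tau> k * riesz_deriv \<alpha> h M (s (q - k)) i)"
    proof -
      have "?D v k - ?D u k = riesz_deriv \<alpha> h M (s (q - k)) i" if "k \<le> q" for k
        using that by (simp add: s_def[abs_def] e_def Suc_diff_le algebra_simps
            flip: riesz_deriv_diff)
      then show ?thesis
        by (simp add: atMost_atLeast0 flip: sum_subtractf right_diff_distrib)
    qed
    also have "\<dots> = C * (\<Sum>k\<le>q. l_coeff \<beta> lam \<tau> k * (\<Sum>j = 1..M - 1. riesz_weight \<alpha> i j * s (q - k) j))"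
      unfolding riesz_deriv_def C_def by (simp add: sum_distrib_left mult_ac)
    finally show ?thesis .
  qed
  define E where "E k = (\<Sum>i = 1..M - 1. e k i * e k i)" for k
  have energy: "E (Suc q) - E q = - C * (\<Sum>k\<le>q. l_coeff \<beta> lam \<tau> k * riesz_form \<alpha> M (s (q - k)) (s q))"
    if "q < N" for q
  proof -
    \<comment> \<open>\<open>a\<^sup>2 - b\<^sup>2 = (a - b) (a + b)\<close> at each grid point\<close>
    have "E (Suc q) - E q = (\<Sum>i = 1..M - 1. (e (Suc q) i - e q i) * s q i)"
      by (simp add: E_def s_def algebra_simps flip: sum_subtractf)
    also have "\<dots> = (\<Sum>i = 1..M - 1. C * (\<Sum>k\<le>q. l_coeff \<beta> lam \<tau> k *
        (\<Sum>j = 1..M - 1. riesz_weight \<alpha> i j * s (q - k) j * s q i)))"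
      by (intro sum.cong refl) (simp add: step that sum_distrib_right mult.assoc)
    also have "\<dots> = C * (\<Sum>k\<le>q. l_coeff \<beta> lam \<tau> k * (\<Sum>i = 1..M - 1.
        \<Sum>j = 1..M - 1. riesz_weight \<alpha> i j * s (q - k) j * s q i))"
      unfolding sum_distrib_left[symmetric] by (subst sum.swap) (simp only: sum_distrib_left)
    also have "\<dots> = - C * (\<Sum>k\<le>q. l_coeff \<beta> lam \<tau> k * riesz_form \<alpha> M (s (q - k)) (s q))"
      by (simp add: riesz_form_def sum_negf)
    finally show ?thesis .
  qed
  have "E n - E 0 = (\<Sum>q<n. E (Suc q) - E q)"
    by (rule sum_lessThan_telescope[symmetric])
  also have "\<dots> = - C * (\<Sum>q<n. \<Sum>k\<le>q. l_coeff \<beta> lam \<tau> k * riesz_form \<alpha> M (s (q - k)) (s q))"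
    unfolding sum_distrib_left using n energy by (intro sum.cong) (auto simp: sum_distrib_left)
  also have "\<dots> \<le> 0"
  proof -
    have "(\<Sum>q<n. \<Sum>k\<le>q. l_coeff \<beta> lam \<tau> k * riesz_form \<alpha> M (s (q - k)) (s q)) \<ge> 0"
      by (rule l_coeff_kernel_nonneg[where G = "\<lambda>m q. riesz_form \<alpha> M (s m) (s q)"])
         (use assms in \<open>auto intro: riesz_form_commute riesz_form_gram_psd\<close>)
    with \<open>C \<ge> 0\<close> show ?thesis by simp
  qed
  finally have "h * E n \<le> h * E 0"
    using assms by (intro mult_left_mono) auto
  then show "grid_norm h M (\<lambda>i. v n i - u n i) \<le> grid_norm h M (\<lambda>i. v 0 i - u 0 i)"
    by (simp add: grid_norm_def grid_inner_def E_def e_def)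
qed

end
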